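(* Let $X$ be a first countable compact Hausdorff space, let $x=(x_n)_{n\in\mathbf{N}}$ be a sequence with values in $X$, let $\mathcal{I}$ be a meager ideal on $\mathbf{N}$, and assume that $x$ is $\mathcal{I}$-convergent to $\ell\in X$. Then the following are equivalent: (1) $\{\sigma\in\Sigma:\sigma(x)\to_{\mathcal{I}}\ell\}$ is comeager in $\Sigma$; (2) $\{\sigma\in\Sigma:\sigma(x)\to_{\mathcal{I}}\ell\}$ is not meager in $\Sigma$; (3) $\{\pi\in\Pi:\pi(x)\to_{\mathcal{I}}\ell\}$ is comeager in $\Pi$; (4) $\{\pi\in\Pi:\pi(x)\to_{\mathcal{I}}\ell\}$ is not meager in $\Pi$; (5) $\lim_{n}x_n=\ell$.
   Context: $\mathbf{N}$ denotes the positive integers. An ideal on $\mathbf{N}$ is a family $\mathcal{I}\subseteq\mathcal{P}(\mathbf{N})$ closed under subsets and finite unions; it is always assumed that $\mathcal{I}$ contains the ideal $\mathrm{Fin}$ of all finite subsets of $\mathbf{N}$ and that $\mathcal{I}\neq\mathcal{P}(\mathbf{N})$. Ideals are regarded as subsets of the Cantor space $\{0,1\}^{\mathbf{N}}$ (identifying sets with characteristic functions); $\mathcal{I}$ is meager if it is a meager subset of this space. A sequence $x=(x_n)$ in a topological space is $\mathcal{I}$-convergent to $\ell$, written $x\to_{\mathcal{I}}\ell$, if $\{n\in\mathbf{N}:x_n\notin U\}\in\mathcal{I}$ for every neighborhood $U$ of $\ell$. $\Sigma$ is the set of strictly increasing functions $\sigma:\mathbf{N}\to\mathbf{N}$ and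 $\Pi$ is the set of bijections $\pi:\mathbf{N}\to\mathbf{N}$; both carry the subspace topology from $\mathbf{N}^{\mathbf{N}}$ (product of discrete topologies), and are Polish. For $\sigma\in\Sigma$, $\sigma(x)$ denotes the subsequence $(x_{\sigma(n)})_n$; for $\pi\in\Pi$, $\pi(x)$ denotes the rearranged sequence $(x_{\pi(n)})_n$. *)

theory Defs
  imports "HOL-Analysis.Analysis"
begin

definition nowhere_dense_in :: "'a topology \<Rightarrow> 'a set \<Rightarrow> bool" where
  "nowhere_dense_in T A \<longleftrightarrow> A \<subseteq> topspace T \<and> T interior_of (T closure_of A) = {}"

definition meager_in :: "'a topology \<Rightarrow> 'a set \<Rightarrow> bool" where
  "meager_in T A \<longleftrightarrow>
     (\<exists>\<F>. countable \<F> \<and> (\<forall>B\<in>\<F>. nowhere_dense_in T B) \<and> A = \<Union>\<F>)"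

definition comeager_in :: "'a topology \<Rightarrow> 'a set \<Rightarrow> bool" where
  "comeager_in T A \<longleftrightarrow> A \<subseteq> topspace T \<and> meager_in T (topspace T - A)"

text \<open>The type \<^typ>\<open>nat\<close> plays the role of the index set of positive integers. All notions
  below depend only on the underlying set and its order, so the shift by one is immaterial.\<close>

definition nat_ideal :: "nat set set \<Rightarrow> bool" where
  "nat_ideal \<I> \<longleftrightarrow>
     (\<forall>A\<in>\<I>. \<forall>B. B \<subseteq> A \<longrightarrow> B \<in> \<I>) \<and>
     (\<forall>A\<in>\<I>. \<forall>B\<in>\<I>. A \<union> B \<in> \<I>) \<and>
     (\<forall>A. finite A \<longrightarrow> A \<in> \<I>) \<and>
     \<I> \<noteq> UNIV"

text \<open>The Cantor space is the type \<^typ>\<open>nat \<Rightarrow> bool\<close> with the product topology of the discrete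
  topology on \<^typ>\<open>bool\<close>; a set is identified with its characteristic function.\<close>

definition meager_ideal :: "nat set set \<Rightarrow> bool" where
  "meager_ideal \<I> \<longleftrightarrow>
     nat_ideal \<I> \<and>
     meager_in (euclidean :: (nat \<Rightarrow> bool) topology) ((\<lambda>A n. n \<in> A) ` \<I>)"

definition ideal_convergent ::
    "nat set set \<Rightarrow> (nat \<Rightarrow> 'a::topological_space) \<Rightarrow> 'a \<Rightarrow> bool" where
  "ideal_convergent \<I> x l \<longleftrightarrow> (\<forall>U. open U \<and> l \<in> U \<longrightarrow> {n. x n \<notin> U} \<in> \<I>)"

text \<open>On \<^typ>\<open>nat \<Rightarrow> nat\<close> the topology \<^term>\<open>euclidean\<close> is the product of discrete topologies.\<close>

definition Sigma_top :: "(nat \<Rightarrow> nat) topology" where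
  "Sigma_top = subtopology euclidean {\<sigma>. strict_mono \<sigma>}"

definition Pi_top :: "(nat \<Rightarrow> nat) topology" where
  "Pi_top = subtopology euclidean {\<pi>. bij \<pi>}"

end

theory Submission
  imports Defs
begin

text \<open>If \<open>x\<close> does not converge to \<open>l\<close>, some neighbourhood of \<open>l\<close> is missed by \<open>x\<close> exactly on an
  infinite set \<open>A\<close>; it lies in the ideal, so it is also coinfinite. The continuous map
  \<open>\<sigma> \<mapsto> \<sigma>\<^sup>-\<^sup>1(A)\<close> into the Cantor space sends every nonempty open set of injections of the relevant
  kind to a set that is dense in some cylinder, because a finite initial segment can be prolonged
  so as to follow any prescribed pattern of membership in \<open>A\<close>. Preimages of meager sets under such
  a map are meager, and the set in question is contained in the preimage of the ideal. If \<open>x\<close>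
  converges to \<open>l\<close>, the set is the whole space, and the claim is Baire's theorem for the two
  Polish spaces.\<close>

section \<open>Meager sets and the Baire category theorem\<close>

lemma meager_in_subset:
  assumes "meager_in T B" and "A \<subseteq> B"
  shows "meager_in T A"
proof -
  obtain \<F> where \<F>: "countable \<F>" "\<And>C. C \<in> \<F> \<Longrightarrow> nowhere_dense_in T C" "B = \<Union>\<F>"
    using assms(1) unfolding meager_in_def by blast
  \<comment> \<open>\<open>meager_in\<close> asks for an exact countable union, so the pieces
    covering \<open>B\<close> are cut down to \<open>A\<close>.\<close>
  have "nowhere_dense_in T (A \<inter> C)" if "C \<in> \<F>" for C
  proof -
    have "T interior_of (T closure_of (A \<inter> C)) \<subseteq> T interior_of (T closure_of C)"
      by (intro interior_of_mono closure_of_mono) simp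
    with \<F>(2)[OF that] show ?thesis
      unfolding nowhere_dense_in_def by blast
  qed
  moreover have "A = \<Union>((\<inter>) A ` \<F>)"
    using assms(2) \<F>(3) by blast
  ultimately show ?thesis
    using \<F>(1) unfolding meager_in_def by blast
qed

lemma meager_in_Un:
  assumes "meager_in T A" and "meager_in T B"
  shows "meager_in T (A \<union> B)"
proof -
  obtain \<F> \<G> where "countable \<F>" "\<forall>C\<in>\<F>. nowhere_dense_in T C" "A = \<Union>\<F>"
    "countable \<G>" "\<forall>C\<in>\<G>. nowhere_dense_in T C" "B = \<Union>\<G>"
    using assms unfolding meager_in_def by blast
  then show ?thesis
    unfolding meager_in_def by (intro exI[of _ "\<F> \<union> \<G>"]) auto
qed

lemma meager_in_empty: "meager_in T {}"
  unfolding meager_in_def by (intro exI[of _ "{}"]) simp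

lemma comeager_in_topspace: "comeager_in T (topspace T)"
  by (simp add: comeager_in_def meager_in_empty)

text \<open>The closures of countably many nowhere dense pieces are closed sets with empty interior.
  By Baire their union has empty interior, whereas a nonempty space is its own interior.\<close>

lemma not_meager_in_topspace:
  assumes "completely_metrizable_space T" and "topspace T \<noteq> {}"
  shows "\<not> meager_in T (topspace T)"
proof
  assume "meager_in T (topspace T)"
  then obtain \<F> where \<F>: "countable \<F>" "\<forall>C\<in>\<F>. nowhere_dense_in T C" "topspace T = \<Union>\<F>"
    unfolding meager_in_def by (elim exE conjE)
  have "T interior_of \<Union>((closure_of) T ` \<F>) = {}"
    using assms(1) \<F>(1,2) by (intro Baire_category_alt) (auto simp: nowhere_dense_in_def)
  moreover have "topspace T = \<Union>((closure_of) T ` \<F>)"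
  proof
    have "C \<subseteq> T closure_of C" if "C \<in> \<F>" for C
      using that \<F>(2) by (simp add: closure_of_subset nowhere_dense_in_def)
    then show "topspace T \<subseteq> \<Union>((closure_of) T ` \<F>)"
      unfolding \<F>(3) by blast
  qed (auto dest: subsetD[OF closure_of_subset_topspace])
  ultimately show False
    using assms(2) by (metis interior_of_topspace)
qed

lemma meager_in_not_comeager_in:
  assumes "completely_metrizable_space T" and "topspace T \<noteq> {}" and "meager_in T A"
  shows "\<not> comeager_in T A"
proof
  assume "comeager_in T A"
  then have "meager_in T (A \<union> (topspace T - A))" and "A \<subseteq> topspace T"
    using assms(3) meager_in_Un unfolding comeager_in_def by blast+
  moreover from \<open>A \<subseteq> topspace T\<close> have "A \<union> (topspace T - A) = topspace T"
    by blast
  ultimately show False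
    using not_meager_in_topspace[OF assms(1,2)] by simp
qed

section \<open>Preimages of meager sets\<close>

text \<open>Continuity maps the interior of the closure of the preimage into the closure of
  \<open>F\<close>; were that interior nonempty, the closure of \<open>F\<close> would have interior
  points. The condition on images speaks of closures because the intended map on bijections has only
  infinite coinfinite sets as values, so images of open sets are at best dense in a
  cylinder.\<close>

lemma nowhere_dense_in_preimage:
  assumes f: "continuous_map X Y f"
    and somewhere_dense: "\<And>U. openin X U \<Longrightarrow> U \<noteq> {} \<Longrightarrow> Y interior_of (Y closure_of (f ` U)) \<noteq> {}"
    and F: "nowhere_dense_in Y F"
  shows "nowhere_dense_in X {x \<in> topspace X. f x \<in> F}"
proof -
  let ?P = "{x \<in> topspace X. f x \<in> F}"
  define U where "U = X interior_of (X closure_of ?P)"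
  have "f ` U \<subseteq> f ` (X closure_of ?P)"
    unfolding U_def by (intro image_mono interior_of_subset)
  also have "\<dots> \<subseteq> Y closure_of (f ` ?P)"
    using f by (rule continuous_map_image_closure_subset)
  also have "\<dots> \<subseteq> Y closure_of F"
    by (intro closure_of_mono) auto
  finally have "Y closure_of (f ` U) \<subseteq> Y closure_of F"
    by (simp add: closure_of_minimal)
  then have "Y interior_of (Y closure_of (f ` U)) = {}"
    using F interior_of_mono unfolding nowhere_dense_in_def by blast
  then have "U = {}"
    using somewhere_dense[of U] unfolding U_def by auto
  then show ?thesis
    unfolding nowhere_dense_in_def U_def by auto
qed

lemma meager_in_preimage:
  assumes "continuous_map X Y f"
    and "\<And>U. openin X U \<Longrightarrow> U \<noteq> {} \<Longrightarrow> Y interior_of (Y closure_of (f ` U)) \<noteq> {}"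
    and "meager_in Y M"
  shows "meager_in X {x \<in> topspace X. f x \<in> M}"
proof -
  obtain \<F> where \<F>: "countable \<F>" "\<And>C. C \<in> \<F> \<Longrightarrow> nowhere_dense_in Y C" "M = \<Union>\<F>"
    using assms(3) unfolding meager_in_def by blast
  let ?\<G> = "(\<lambda>C. {x \<in> topspace X. f x \<in> C}) ` \<F>"
  have "\<forall>B\<in>?\<G>. nowhere_dense_in X B"
    using nowhere_dense_in_preimage[OF assms(1,2)] \<F>(2) by auto
  moreover have "{x \<in> topspace X. f x \<in> M} = \<Union>?\<G>"
    using \<F>(3) by auto
  ultimately show ?thesis
    using \<F>(1) unfolding meager_in_def by blast
qed

text \<open>A basic open box restricts only finitely many coordinates; any \<open>k\<close> beyond
  all of them works.\<close>

lemma open_fun_contains_cylinder: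
  fixes U :: "(nat \<Rightarrow> 'b::topological_space) set"
  assumes "open U" and "f \<in> U"
  shows "\<exists>k. \<forall>g. (\<forall>n<k. g n = f n) \<longrightarrow> g \<in> U"
proof -
  have "openin (product_topology (\<lambda>i. euclidean) UNIV) U"
    using assms(1) by (simp add: open_fun_def)
  then obtain X where X: "f \<in> Pi\<^sub>E UNIV X" "finite {i. X i \<noteq> UNIV}" "Pi\<^sub>E UNIV X \<subseteq> U"
    using product_topology_open_contains_basis[of "\<lambda>i. euclidean" UNIV U f] assms(2) by auto
  obtain k where k: "\<And>i. X i \<noteq> UNIV \<Longrightarrow> i < k"
    using X(2) finite_nat_set_iff_bounded[of "{i. X i \<noteq> UNIV}"] by auto
  show ?thesis
  proof (intro exI allI impI)
    fix g assume g: "\<forall>n<k. g n = f n"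
    have "g i \<in> X i" for i
    proof (cases "X i = UNIV")
      case False
      with k g X(1) show ?thesis by (metis PiE_mem UNIV_I)
    qed simp
    then show "g \<in> U"
      using X(3) by (auto simp: PiE_UNIV_domain)
  qed
qed

lemma open_cylinder:
  fixes f :: "nat \<Rightarrow> 'b::discrete_topology"
  shows "open {g. \<forall>n<k. g n = f n}"
proof -
  have "{g. \<forall>n<k. g n = f n} = (\<Inter>n<k. (\<lambda>g. g n) -` {f n})"
    by auto
  then show ?thesis
    by (auto intro!: open_INT open_vimage continuous_on_product_coordinates open_discrete)
qed

text \<open>The hypothesis \<open>prolong\<close> is density in combinatorial form, stated for a
  general \<open>D\<close> to serve both strictly increasing maps and bijections. The first
  \<open>k\<close> places are kept, and membership in \<open>A\<close> is prescribed on the first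
  \<open>m\<close>.\<close>

lemma meager_preimage_ideal:
  fixes D :: "(nat \<Rightarrow> nat) set" and A :: "nat set"
  assumes "meager_ideal \<I>"
    and prolong: "\<And>\<sigma> k m B. \<sigma> \<in> D \<Longrightarrow> \<forall>n<k. \<sigma> n \<in> A \<longleftrightarrow> n \<in> B \<Longrightarrow>
      \<exists>\<tau>\<in>D. (\<forall>n<k. \<tau> n = \<sigma> n) \<and> (\<forall>n<m. \<tau> n \<in> A \<longleftrightarrow> n \<in> B)"
  shows "meager_in (subtopology euclidean D) {\<sigma> \<in> D. \<sigma> -` A \<in> \<I>}"
proof -
  let ?f = "\<lambda>\<sigma> n::nat. \<sigma> n \<in> A"
  have "continuous_on UNIV (\<lambda>\<sigma>::nat \<Rightarrow> nat. \<sigma> n \<in> A)" for n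
    using continuous_on_compose[OF continuous_on_product_coordinates[of n],
        of "\<lambda>j::nat. j \<in> A"]
    by (simp add: comp_def)
  then have "continuous_on UNIV ?f"
    by (rule continuous_on_coordinatewise_then_product)
  then have cont: "continuous_map (subtopology euclidean D) euclidean ?f"
    by (auto intro: continuous_on_subset)
  have dense: "euclidean interior_of (euclidean closure_of (?f ` U)) \<noteq> {}"
    if U: "openin (subtopology euclidean D) U" "U \<noteq> {}" for U
  proof -
    obtain V where V: "open V" "U = D \<inter> V"
      using U(1) by (auto simp: openin_open)
    obtain \<sigma> where \<sigma>: "\<sigma> \<in> V" "\<sigma> \<in> D"
      using U(2) V by auto
    obtain k where k: "\<forall>\<tau>. (\<forall>n<k. \<tau> n = \<sigma> n) \<longrightarrow> \<tau> \<in> V"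
      using open_fun_contains_cylinder[OF V(1) \<sigma>(1)] ..
    \<comment> \<open>Keeping the first \<open>k\<close> values of \<open>\<sigma>\<close> fixes the
      first \<open>k\<close> bits of the pattern and, by \<open>prolong\<close>, leaves any finite
      stretch of later bits free. Hence the image of \<open>U\<close> is dense in this
      cylinder.\<close>
    let ?C = "{\<phi>. \<forall>n<k. \<phi> n = ?f \<sigma> n}"
    have "?C \<subseteq> closure (?f ` U)"
    proof
      fix \<phi> assume \<phi>: "\<phi> \<in> ?C"
      show "\<phi> \<in> closure (?f ` U)"
        unfolding closure_iff_nhds_not_empty
      proof (intro allI impI)
        fix N W assume W: "W \<subseteq> N" "open W" "\<phi> \<in> W"
        obtain m where m: "\<forall>\<psi>. (\<forall>n<m. \<psi> n = \<phi> n) \<longrightarrow> \<psi> \<in> W"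
          using open_fun_contains_cylinder[OF W(2,3)] ..
        obtain \<tau> where \<tau>: "\<tau> \<in> D" "\<forall>n<k. \<tau> n = \<sigma> n" "\<forall>n<m. \<tau> n \<in> A \<longleftrightarrow> n \<in> Collect \<phi>"
          using prolong[OF \<sigma>(2), of k "Collect \<phi>" m] \<phi> by auto
        have "\<tau> \<in> U"
          using k \<tau>(1,2) V(2) by auto
        moreover have "?f \<tau> \<in> W"
          using m \<tau>(3) by auto
        ultimately show "?f ` U \<inter> N \<noteq> {}"
          using W(1) by auto
      qed
    qed
    moreover have "open ?C"
      by (rule open_cylinder)
    ultimately have "?C \<subseteq> interior (closure (?f ` U))"
      by (rule interior_maximal)
    moreover have "?f \<sigma> \<in> ?C"
      by simp
    ultimately show ?thesis
      by (auto simp del: mem_Collect_eq)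
  qed
  have "meager_in euclidean ((\<lambda>A n. n \<in> A) ` \<I>)"
    using assms(1) by (simp add: meager_ideal_def)
  from meager_in_preimage[OF cont dense this]
  have "meager_in (subtopology euclidean D) {\<sigma> \<in> D. ?f \<sigma> \<in> (\<lambda>A n. n \<in> A) ` \<I>}"
    by simp
  then show ?thesis
  proof (rule meager_in_subset)
    show "{\<sigma> \<in> D. \<sigma> -` A \<in> \<I>} \<subseteq> {\<sigma> \<in> D. ?f \<sigma> \<in> (\<lambda>A n. n \<in> A) ` \<I>}"
      by (auto intro!: image_eqI[of _ _ "_ -` A"])
  qed
qed

section \<open>Prolonging initial segments to follow a prescribed pattern\<close>

text \<open>Both \<open>A\<close> and its complement are unbounded, so after the fixed segment each
  next value can be chosen larger than the last and on the required side. The recursion realises all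
  of \<open>B\<close> at once.\<close>

lemma strict_mono_prolong:
  fixes A :: "nat set" and \<sigma> :: "nat \<Rightarrow> nat"
  assumes "infinite A" and "infinite (- A)" and "strict_mono \<sigma>"
    and agree: "\<forall>n<k. \<sigma> n \<in> A \<longleftrightarrow> n \<in> B"
  shows "\<exists>\<tau>. strict_mono \<tau> \<and> (\<forall>n<k. \<tau> n = \<sigma> n) \<and> (\<forall>n. \<tau> n \<in> A \<longleftrightarrow> n \<in> B)"
proof -
  have larger: "\<exists>j>i. j \<in> A \<longleftrightarrow> n \<in> B" for i n
    using assms(1,2) by (cases "n \<in> B") (auto simp: infinite_nat_iff_unbounded)
  have "\<exists>\<tau>. \<forall>n. ((n < k \<longrightarrow> \<tau> n = \<sigma> n) \<and> (\<tau> n \<in> A \<longleftrightarrow> n \<in> B)) \<and> \<tau> n < \<tau> (Suc n)"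
  proof (rule dependent_nat_choice)
    show "\<exists>i. (0 < k \<longrightarrow> i = \<sigma> 0) \<and> (i \<in> A \<longleftrightarrow> 0 \<in> B)"
      using agree larger[of 0 0] by (cases "0 < k") auto
    fix i n assume i: "(n < k \<longrightarrow> i = \<sigma> n) \<and> (i \<in> A \<longleftrightarrow> n \<in> B)"
    show "\<exists>j. ((Suc n < k \<longrightarrow> j = \<sigma> (Suc n)) \<and> (j \<in> A \<longleftrightarrow> Suc n \<in> B)) \<and> i < j"
    proof (cases "Suc n < k")
      case True
      then have "i < \<sigma> (Suc n)"
        using i assms(3) by (simp add: strict_mono_Suc_iff)
      then show ?thesis
        using True agree by blast
    next
      case False
      then show ?thesis
        using larger[of i "Suc n"] by blast
    qed
  qed
  then show ?thesis
    by (auto simp: strict_mono_Suc_iff)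
qed

text \<open>Places are corrected one at a time by transposing with a later place, which preserves
  bijectivity. Only the first \<open>m\<close> places are controlled: the preimage of
  \<open>A\<close> under a bijection is infinite and coinfinite, so not every \<open>B\<close> is
  attained in full.\<close>

lemma bij_prolong:
  fixes A :: "nat set" and \<pi> :: "nat \<Rightarrow> nat"
  assumes "infinite A" and "infinite (- A)" and "bij \<pi>"
    and agree: "\<forall>n<k. \<pi> n \<in> A \<longleftrightarrow> n \<in> B"
  shows "\<exists>\<rho>. bij \<rho> \<and> (\<forall>n<k. \<rho> n = \<pi> n) \<and> (\<forall>n<m. \<rho> n \<in> A \<longleftrightarrow> n \<in> B)"
proof (induction m)
  case 0
  then show ?case
    using assms(3) by auto
next
  case (Suc m)
  then obtain \<rho> where \<rho>: "bij \<rho>" "\<forall>n<k. \<rho> n = \<pi> n" "\<forall>n<m. \<rho> n \<in> A \<longleftrightarrow> n \<in> B"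
    by blast
  show ?case
  proof (cases "m < k")
    case True
    then show ?thesis
      using \<rho> agree by (intro exI[of _ \<rho>]) (auto simp: less_Suc_eq)
  next
    case False
    \<comment> \<open>A bijection pulls infinite sets back to infinite sets, so a suitable
      \<open>j\<close> exists beyond \<open>m\<close>; the swap then leaves all places below
      \<open>m\<close>, in particular the first \<open>k\<close>, untouched.\<close>
    have "infinite (\<rho> -` (if m \<in> B then A else - A))"
      using assms(1,2) \<rho>(1) by (simp add: finite_vimage_iff)
    then obtain j where j: "m < j" "\<rho> j \<in> A \<longleftrightarrow> m \<in> B"
      unfolding infinite_nat_iff_unbounded by (auto split: if_splits)
    define \<tau> where "\<tau> = \<rho> \<circ> Transposition.transpose m j"
    have "\<tau> n = \<rho> n" if "n < m" for n
      using that j(1) by (simp add: \<tau>_def transpose_def)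
    moreover have "\<tau> m = \<rho> j" and "bij \<tau>"
      using \<rho>(1) by (simp_all add: \<tau>_def bij_comp)
    ultimately show ?thesis
      using \<rho> j(2) False by (intro exI[of _ \<tau>]) (auto simp: less_Suc_eq)
  qed
qed

section \<open>Complete metrizability of the two function spaces\<close>

lemma completely_metrizable_Baire_space:
  "completely_metrizable_space (euclidean :: (nat \<Rightarrow> 'b::discrete_topology) topology)"
proof -
  have "(euclidean :: 'b topology) = discrete_topology UNIV"
    by (simp add: topology_eq open_discrete)
  then have "completely_metrizable_space (product_topology (\<lambda>i::nat. euclidean :: 'b topology) UNIV)"
    by (simp add: completely_metrizable_space_product_topology
        completely_metrizable_space_discrete_topology)
  then show ?thesis
    by (simp add: euclidean_product_topology)
qed

lemma completely_metrizable_space_Inter_open: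
  assumes "completely_metrizable_space X" and "countable \<U>" and "\<And>U. U \<in> \<U> \<Longrightarrow> openin X U"
  shows "completely_metrizable_space (subtopology X (\<Inter>\<U>))"
\<comment> \<open>The empty family has intersection \<open>UNIV\<close>, which gives back
  \<open>X\<close>; otherwise the intersection is a G-delta set.\<close>
proof (cases "\<U> = {}")
  case False
  then have "gdelta_in X (\<Inter>\<U>)"
    using assms by (intro gdelta_in_Inter open_imp_gdelta_in) auto
  with assms(1) show ?thesis
    by (rule completely_metrizable_space_gdelta_in)
qed (simp add: assms(1))

text \<open>Strict monotonicity is a countable conjunction of inequalities between consecutive
  values, each an open condition.\<close>

lemma completely_metrizable_Sigma_top: "completely_metrizable_space Sigma_top"
proof -
  have "open {\<sigma>::nat \<Rightarrow> nat. \<sigma> n < \<sigma> (Suc n)}" for n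
    by (intro open_Collect_less continuous_on_product_coordinates)
  then have "completely_metrizable_space
      (subtopology euclidean (\<Inter>n. {\<sigma>::nat \<Rightarrow> nat. \<sigma> n < \<sigma> (Suc n)}))"
    by (intro completely_metrizable_space_Inter_open completely_metrizable_Baire_space) auto
  moreover have "{\<sigma>::nat \<Rightarrow> nat. strict_mono \<sigma>} = (\<Inter>n. {\<sigma>. \<sigma> n < \<sigma> (Suc n)})"
    by (auto simp: strict_mono_Suc_iff)
  ultimately show ?thesis
    by (simp add: Sigma_top_def)
qed

lemma completely_metrizable_Pi_top: "completely_metrizable_space Pi_top"
proof -
  \<comment> \<open>Injectivity is a countable conjunction of open conditions on pairs of places,
    with \<open>UNIV\<close> on the diagonal so that all pairs may be indexed. Surjectivity is one
    open condition for each target value \<open>j\<close>.\<close>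
  define inj_at :: "nat \<times> nat \<Rightarrow> (nat \<Rightarrow> nat) set"
    where "inj_at = (\<lambda>(m, n). if m = n then UNIV else {\<pi>. \<pi> m \<noteq> \<pi> n})"
  define surj_at :: "nat \<Rightarrow> (nat \<Rightarrow> nat) set"
    where "surj_at j = (\<Union>n. (\<lambda>\<pi>. \<pi> n) -` {j})" for j
  have "open (inj_at p)" for p
    by (auto simp: inj_at_def split: prod.split
        intro!: open_Collect_neq continuous_on_product_coordinates)
  moreover have "open (surj_at j)" for j
    unfolding surj_at_def
    by (intro open_UN ballI open_vimage continuous_on_product_coordinates open_discrete)
  ultimately have "completely_metrizable_space
      (subtopology euclidean (\<Inter>(range inj_at \<union> range surj_at)))"
    by (intro completely_metrizable_space_Inter_open completely_metrizable_Baire_space) auto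
  moreover have "{\<pi>::nat \<Rightarrow> nat. bij \<pi>} = \<Inter>(range inj_at \<union> range surj_at)"
  proof -
    have "inj \<pi> \<longleftrightarrow> (\<forall>p. \<pi> \<in> inj_at p)" for \<pi>
      by (auto simp: inj_at_def inj_def)
    moreover have "surj \<pi> \<longleftrightarrow> (\<forall>j. \<pi> \<in> surj_at j)" for \<pi>
      by (auto simp: surj_at_def surj_def eq_commute)
    ultimately show ?thesis
      by (auto simp: bij_def)
  qed
  ultimately show ?thesis
    by (simp add: Pi_top_def)
qed

section \<open>The convergent and the nonconvergent case\<close>

text \<open>Only finitely many terms of \<open>x\<close> leave a neighbourhood; an injection pulls
  this finite set of indices back to a finite set, which lies in the ideal.\<close>

lemma ideal_convergent_inj_subseq:
  assumes "nat_ideal \<I>" and "x \<longlonglongrightarrow> l" and "inj \<sigma>"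
  shows "ideal_convergent \<I> (\<lambda>n. x (\<sigma> n)) l"
  unfolding ideal_convergent_def
proof (intro allI impI)
  fix U assume "open U \<and> l \<in> U"
  then have "eventually (\<lambda>n. x n \<in> U) sequentially"
    using assms(2) by (auto dest: topological_tendstoD)
  then have "finite {n. x n \<notin> U}"
    by (simp add: cofinite_eq_sequentially[symmetric] eventually_cofinite)
  then have "finite (\<sigma> -` {n. x n \<notin> U})"
    using assms(3) by (rule finite_vimageI)
  then show "{n. x (\<sigma> n) \<notin> U} \<in> \<I>"
    using assms(1) by (simp add: nat_ideal_def vimage_def)
qed

lemma not_convergent_meager:
  fixes x :: "nat \<Rightarrow> 'a::topological_space" and D :: "(nat \<Rightarrow> nat) set"
  assumes \<I>: "meager_ideal \<I>" and conv: "ideal_convergent \<I> x l" and "\<not> x \<longlonglongrightarrow> l"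
    and prolong: "\<And>A \<sigma> k m B. infinite A \<Longrightarrow> infinite (- A) \<Longrightarrow> \<sigma> \<in> D \<Longrightarrow>
      \<forall>n<k. \<sigma> n \<in> A \<longleftrightarrow> n \<in> B \<Longrightarrow>
      \<exists>\<tau>\<in>D. (\<forall>n<k. \<tau> n = \<sigma> n) \<and> (\<forall>n<m. \<tau> n \<in> A \<longleftrightarrow> n \<in> B)"
  shows "meager_in (subtopology euclidean D)
    {\<sigma> \<in> D. ideal_convergent \<I> (\<lambda>n. x (\<sigma> n)) l}"
proof -
  obtain U where U: "open U" "l \<in> U" "\<not> eventually (\<lambda>n. x n \<in> U) sequentially"
    using assms(3) unfolding tendsto_def by blast
  define A where "A = {n. x n \<notin> U}"
  have "infinite A"
    using U(3) by (simp add: A_def cofinite_eq_sequentially[symmetric] eventually_cofinite)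
  \<comment> \<open>Ideal convergence puts \<open>A\<close> into the ideal. A finite complement
    would put the whole index set there too, against properness.\<close>
  moreover have "infinite (- A)"
  proof
    assume "finite (- A)"
    have ideal: "nat_ideal \<I>"
      using \<I> by (simp add: meager_ideal_def)
    have "A \<in> \<I>"
      using conv U(1,2) by (simp add: A_def ideal_convergent_def)
    moreover have "- A \<in> \<I>"
      using ideal \<open>finite (- A)\<close> by (simp add: nat_ideal_def)
    ultimately have "A \<union> - A \<in> \<I>"
      using ideal unfolding nat_ideal_def by blast
    then have "\<I> = UNIV"
      using ideal unfolding nat_ideal_def by auto
    then show False
      using ideal by (simp add: nat_ideal_def)
  qed
  ultimately have "meager_in (subtopology euclidean D) {\<sigma> \<in> D. \<sigma> -` A \<in> \<I>}"
    using \<I> prolong by (intro meager_preimage_ideal) auto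
  \<comment> \<open>Applied to the neighbourhood \<open>U\<close>, ideal convergence of the
    reindexed sequence says that the preimage of \<open>A\<close> lies in the ideal.\<close>
  then show ?thesis
    by (rule meager_in_subset) (use U(1,2) in \<open>auto simp: ideal_convergent_def A_def vimage_def\<close>)
qed

theorem corollary2p7:
  fixes x :: "nat \<Rightarrow> 'a :: {t2_space, first_countable_topology}"
    and l :: 'a
    and \<I> :: "nat set set"
  assumes "compact (UNIV :: 'a set)"
    and "meager_ideal \<I>"
    and "ideal_convergent \<I> x l"
  shows "let S = {\<sigma>. strict_mono \<sigma> \<and> ideal_convergent \<I> (\<lambda>n. x (\<sigma> n)) l};
             P = {\<pi>. bij \<pi> \<and> ideal_convergent \<I> (\<lambda>n. x (\<pi> n)) l}
         in (comeager_in Sigma_top S \<longleftrightarrow> \<not> meager_in Sigma_top S) \<and>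
            (\<not> meager_in Sigma_top S \<longleftrightarrow> comeager_in Pi_top P) \<and>
            (comeager_in Pi_top P \<longleftrightarrow> \<not> meager_in Pi_top P) \<and>
            (\<not> meager_in Pi_top P \<longleftrightarrow> x \<longlonglongrightarrow> l)"
proof -
  define S where "S = {\<sigma>. strict_mono \<sigma> \<and> ideal_convergent \<I> (\<lambda>n. x (\<sigma> n)) l}"
  define P where "P = {\<pi>. bij \<pi> \<and> ideal_convergent \<I> (\<lambda>n. x (\<pi> n)) l}"
  have nonempty: "topspace Sigma_top \<noteq> {}" "topspace Pi_top \<noteq> {}"
    using strict_mono_id bij_id by (auto simp: Sigma_top_def Pi_top_def simp del: bij_id)
  note Baire_Sigma = completely_metrizable_Sigma_top nonempty(1)
    and Baire_Pi = completely_metrizable_Pi_top nonempty(2)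
  \<comment> \<open>All four category statements hold if \<open>x\<close> converges to
    \<open>l\<close> and all four fail otherwise, which gives every equivalence at once.\<close>
  have "comeager_in Sigma_top S \<and> \<not> meager_in Sigma_top S \<and>
      comeager_in Pi_top P \<and> \<not> meager_in Pi_top P" if "x \<longlonglongrightarrow> l"
  proof -
    have "nat_ideal \<I>"
      using assms(2) by (simp add: meager_ideal_def)
    then have conv: "ideal_convergent \<I> (\<lambda>n. x (\<sigma> n)) l" if "inj \<sigma>" for \<sigma>
      using ideal_convergent_inj_subseq \<open>x \<longlonglongrightarrow> l\<close> that by blast
    have "S = topspace Sigma_top" "P = topspace Pi_top"
      unfolding S_def P_def Sigma_top_def Pi_top_def
      using conv[OF strict_mono_imp_inj_on] conv[OF bij_is_inj] by auto
    then show ?thesis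
      using not_meager_in_topspace[OF Baire_Sigma] not_meager_in_topspace[OF Baire_Pi]
      by (simp add: comeager_in_topspace)
  qed
  moreover have "\<not> comeager_in Sigma_top S \<and> meager_in Sigma_top S \<and>
      \<not> comeager_in Pi_top P \<and> meager_in Pi_top P" if "\<not> x \<longlonglongrightarrow> l"
  proof -
    have "meager_in Sigma_top {\<sigma> \<in> Collect strict_mono. ideal_convergent \<I> (\<lambda>n. x (\<sigma> n)) l}"
      unfolding Sigma_top_def
    proof (rule not_convergent_meager[OF assms(2,3) that], goal_cases)
      case (1 A \<sigma> k m B)
      then show ?case
        using strict_mono_prolong[of A \<sigma> k B] by auto
    qed
    then have "meager_in Sigma_top S"
      by (simp add: S_def)
    moreover have "meager_in Pi_top {\<pi> \<in> Collect bij. ideal_convergent \<I> (\<lambda>n. x (\<pi> n)) l}"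
      unfolding Pi_top_def
    proof (rule not_convergent_meager[OF assms(2,3) that], goal_cases)
      case (1 A \<pi> k m B)
      then show ?case
        using bij_prolong[of A \<pi> k B m] by auto
    qed
    then have "meager_in Pi_top P"
      by (simp add: P_def)
    \<comment> \<open>In a nonempty completely metrizable space a meager set cannot also be
      comeager.\<close>
    ultimately show ?thesis
      using meager_in_not_comeager_in Baire_Sigma Baire_Pi by blast
  qed
  ultimately show ?thesis
    unfolding Let_def S_def[symmetric] P_def[symmetric] by blast
qed

end
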